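(* Let $k,w,s\in\mathbb Z_{>0}$. The minimum number of steps in a sequence of partitions from $\delta_k^{(w,s)}$ to $\delta_{k+1}^{(w,s)}$ with each successive difference a horizontal strip is $s$. The unique sequence attaining this minimum is \[ \bigl(\delta_{k,g}^{(w,s)}\bigr)_{g=0}^{s}. \]
   Context: A partition is a weakly decreasing sequence of nonnegative integers with finitely many nonzero parts, identified with its Young diagram $\{(i,j)\in\mathbb Z_{>0}^2:1\le j\le\lambda_i\}$ (rows indexed from top to bottom). Exponents on parts denote multiplicities; a part with multiplicity $0$ is omitted. Generalized staircase partitions: for $w,s\in\mathbb Z_{>0}$, $\delta_1^{(w,s)}=\varnothing$ and, for $k\ge2$, $\delta_k^{(w,s)}=\bigl((w(k-1))^s,(w(k-2))^s,\ldots,w^s\bigr)$. Intermediate generalized staircase partitions: for $0\le g\le s$, $\delta_{1,g}^{(w,s)}=(w^g)$ (with $\delta_{1,0}^{(w,s)}=\varnothing$) and, for $k\ge2$, $\delta_{k,g}^{(w,s)}=\bigl((wk)^g,(w(k-1))^s,(w(k-2))^s,\ldots,w^s\bigr)$. Thus $\delta_{k,0}^{(w,s)}=\delta_k^{(w,s)}$ and $\delta_{k,s}^{(w,s)}=\delta_{k+1}^{(w,s)}$. For $\mu\subseteq\lambda$ (i.e. $\mu_i\le\lambda_i$ for all $i$), the skew diagram $\lambda/\mu$ is the set difference of Young diagrams; it is a horizontal strip if it contains at most one box in each column. A sequence of partitions from $\alpha$ to $\beta$ with $m$ steps and each successive difference a horizontal strip is a sequence $\alpha=\lambda^{(0)}\subseteq\lambda^{(1)}\subseteq\cdots\subseteq\lambda^{(m)}=\beta$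 of partitions such that every $\lambda^{(i)}/\lambda^{(i-1)}$, $1\le i\le m$, is a horizontal strip. *)

theory Defs
  imports Main "HOL-Library.More_List"
begin

text \<open>
  Partitions are infinite sequences of parts, indexed from 0 (so \<open>p i\<close> is the part usually
  written with index \<open>i + 1\<close>). Hence trailing zeros do not affect equality of partitions, and
  containment of partitions is the pointwise order \<open>\<le>\<close> on functions.
\<close>

definition is_partition :: "(nat \<Rightarrow> nat) \<Rightarrow> bool" where
  "is_partition p \<longleftrightarrow> antimono p \<and> finite {i. p i \<noteq> 0}"

text \<open>Boxes are pairs (row, column), both coordinates counted from 1.\<close>

definition young_diagram :: "(nat \<Rightarrow> nat) \<Rightarrow> (nat \<times> nat) set" where
  "young_diagram p = {(i, j). 1 \<le> i \<and> 1 \<le> j \<and> j \<le> p (i - 1)}"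

definition skew_diagram :: "(nat \<Rightarrow> nat) \<Rightarrow> (nat \<Rightarrow> nat) \<Rightarrow> (nat \<times> nat) set" where
  "skew_diagram p q = young_diagram p - young_diagram q"

definition horizontal_strip :: "(nat \<times> nat) set \<Rightarrow> bool" where
  "horizontal_strip D \<longleftrightarrow> (\<forall>i i' j. (i, j) \<in> D \<longrightarrow> (i', j) \<in> D \<longrightarrow> i = i')"

definition strip_sequence ::
  "(nat \<Rightarrow> nat) \<Rightarrow> (nat \<Rightarrow> nat) \<Rightarrow> nat \<Rightarrow> (nat \<Rightarrow> nat) list \<Rightarrow> bool" where
  "strip_sequence \<alpha> \<beta> m ps \<longleftrightarrow>
     length ps = m + 1 \<and> (\<forall>p \<in> set ps. is_partition p) \<and> ps ! 0 = \<alpha> \<and> ps ! m = \<beta> \<and>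
     (\<forall>i \<in> {1..m}. ps ! (i - 1) \<le> ps ! i \<and> horizontal_strip (skew_diagram (ps ! i) (ps ! (i - 1))))"

definition staircase_parts :: "nat \<Rightarrow> nat \<Rightarrow> nat \<Rightarrow> nat list" where
  "staircase_parts w s k = concat (map (\<lambda>j. replicate s (w * j)) (rev [1..<k]))"

definition staircase :: "nat \<Rightarrow> nat \<Rightarrow> nat \<Rightarrow> (nat \<Rightarrow> nat)" where
  "staircase w s k = nth_default 0 (staircase_parts w s k)"

definition intermediate_staircase :: "nat \<Rightarrow> nat \<Rightarrow> nat \<Rightarrow> nat \<Rightarrow> (nat \<Rightarrow> nat)" where
  "intermediate_staircase w s k g = nth_default 0 (replicate g (w * k) @ staircase_parts w s k)"

lemma intermediate_staircase_0: "intermediate_staircase w s k 0 = staircase w s k"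
  by (simp add: intermediate_staircase_def staircase_def)

lemma intermediate_staircase_full:
  "k \<ge> 1 \<Longrightarrow> intermediate_staircase w s k s = staircase w s (k + 1)"
  by (simp add: intermediate_staircase_def staircase_def staircase_parts_def)

end

theory Submission
  imports Defs
begin

text \<open>
  Number rows from \<open>0\<close>. For partitions, \<open>q / p\<close> is a horizontal strip exactly when the rows interlace, that is,
  \<open>q (i + 1) \<le> p i\<close> for every row \<open>i\<close> (lemma \<open>horizontal_strip_iff_interlacing\<close>). Along a
  sequence of strips this inequality iterates: after \<open>d\<close> steps, row \<open>i + d\<close> is bounded by
  row \<open>i\<close> of the partition \<open>d\<close> steps earlier (lemma \<open>strip_sequence_shift\<close>).

  The top partition \<open>\<delta>\<^sub>k\<^sub>+\<^sub>1\<close> is \<open>\<delta>\<^sub>k\<close> pushed down by \<open>s\<close> rows, with \<open>s\<close> rows of length \<open>w k\<close>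
  placed above it. If \<open>m < s\<close>, then row \<open>m\<close> of \<open>\<delta>\<^sub>k\<^sub>+\<^sub>1\<close> has length \<open>w k\<close>, whereas row \<open>0\<close> of \<open>\<delta>\<^sub>k\<close>
  is shorter, so \<open>m\<close> steps cannot suffice.

  If there are exactly \<open>s\<close> steps, the partition reached after \<open>g\<close> steps is squeezed from both
  sides: row \<open>i\<close> is at least row \<open>i + (s - g)\<close> of \<open>\<delta>\<^sub>k\<^sub>+\<^sub>1\<close>, and at most row \<open>i\<close> of \<open>\<delta>\<^sub>k\<^sub>+\<^sub>1\<close> and, when
  \<open>i \<ge> g\<close>, at most row \<open>i - g\<close> of \<open>\<delta>\<^sub>k\<close>. For \<open>i < g\<close> both bounds are \<open>w k\<close>. For \<open>i \<ge> g\<close> the lower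
  bound is row \<open>(i - g) + s\<close> of \<open>\<delta>\<^sub>k\<^sub>+\<^sub>1\<close>, which is row \<open>i - g\<close> of \<open>\<delta>\<^sub>k\<close>, so the bounds again
  agree. Their common value is the intermediate staircase. Conversely, row \<open>i + 1\<close> of
  each intermediate staircase equals row \<open>i\<close> of the preceding one, so consecutive ones interlace.
\<close>

lemma antimono_if_is_partition:
  assumes "is_partition p" and "i \<le> j"
  shows "p j \<le> p i"
  using assms by (auto simp: is_partition_def antimono_def)

text \<open>
  If interlacing fails at row \<open>i\<close>, then \<open>q / p\<close> has a box in column \<open>p i + 1\<close> both in row \<open>i\<close> and in row
  \<open>i + 1\<close>. If it holds, then for \<open>a < b\<close> row \<open>b\<close> of \<open>q\<close> is no longer than row \<open>a + 1\<close> of \<open>q\<close>, hence no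
  longer than row \<open>a\<close> of \<open>p\<close>, so it ends before row \<open>a\<close> of \<open>q / p\<close> begins.
\<close>
lemma horizontal_strip_iff_interlacing:
  assumes p: "is_partition p" and q: "is_partition q"
  shows "horizontal_strip (skew_diagram q p) \<longleftrightarrow> (\<forall>i. q (Suc i) \<le> p i)"
proof
  assume strip: "horizontal_strip (skew_diagram q p)"
  show "\<forall>i. q (Suc i) \<le> p i"
  proof (intro allI, rule ccontr)
    fix i assume "\<not> q (Suc i) \<le> p i"
    moreover have "q (Suc i) \<le> q i" "p (Suc i) \<le> p i"
      using antimono_if_is_partition[OF q] antimono_if_is_partition[OF p] by simp_all
    ultimately have "(Suc i, Suc (p i)) \<in> skew_diagram q p"
        "(Suc (Suc i), Suc (p i)) \<in> skew_diagram q p"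
      by (auto simp: skew_diagram_def young_diagram_def)
    then show False
      using strip unfolding horizontal_strip_def by (metis n_not_Suc_n)
  qed
next
  assume interlacing: "\<forall>i. q (Suc i) \<le> p i"
  have not_above: "\<not> a < b"
    if ab: "(a, j) \<in> skew_diagram q p" "(b, j) \<in> skew_diagram q p" for a b j
  proof
    assume "a < b"
    have a: "1 \<le> a" "p (a - 1) < j" and b: "j \<le> q (b - 1)"
      using ab by (auto simp: skew_diagram_def young_diagram_def)
    have "q (b - 1) \<le> q a"
      using \<open>a < b\<close> by (intro antimono_if_is_partition[OF q]) simp
    moreover have "q a \<le> p (a - 1)"
      using interlacing[rule_format, of "a - 1"] a(1) by simp
    ultimately show False
      using a(2) b by linarith
  qed
  then show "horizontal_strip (skew_diagram q p)"
    unfolding horizontal_strip_def by (meson linorder_neqE_nat)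
qed

lemma strip_sequence_partition:
  assumes "strip_sequence \<alpha> \<beta> m ps" and "g \<le> m"
  shows "is_partition (ps ! g)"
  using assms by (auto simp: strip_sequence_def)

lemma strip_sequence_step:
  assumes seq: "strip_sequence \<alpha> \<beta> m ps" and "g < m"
  shows "ps ! g \<le> ps ! Suc g" and "(ps ! Suc g) (Suc i) \<le> (ps ! g) i"
proof -
  have "Suc g \<in> {1..m}"
    using \<open>g < m\<close> by simp
  then have step: "ps ! (Suc g - 1) \<le> ps ! Suc g"
      "horizontal_strip (skew_diagram (ps ! Suc g) (ps ! (Suc g - 1)))"
    using seq unfolding strip_sequence_def by blast+
  then show "ps ! g \<le> ps ! Suc g"
    by simp
  have "is_partition (ps ! g)" "is_partition (ps ! Suc g)"
    using \<open>g < m\<close> by (auto intro: strip_sequence_partition[OF seq])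
  then show "(ps ! Suc g) (Suc i) \<le> (ps ! g) i"
    using step(2) horizontal_strip_iff_interlacing by simp
qed

lemma strip_sequence_mono:
  assumes "strip_sequence \<alpha> \<beta> m ps" and "g + d \<le> m"
  shows "ps ! g \<le> ps ! (g + d)"
  using assms(2)
proof (induction d)
  case (Suc d)
  then have "ps ! g \<le> ps ! (g + d)"
    by simp
  also have "\<dots> \<le> ps ! (g + Suc d)"
    using strip_sequence_step(1)[OF assms(1), of "g + d"] Suc.prems by simp
  finally show ?case .
qed simp

lemma strip_sequence_shift:
  assumes "strip_sequence \<alpha> \<beta> m ps" and "g + d \<le> m"
  shows "(ps ! (g + d)) (i + d) \<le> (ps ! g) i"
  using assms(2)
proof (induction d)
  case (Suc d)
  have "(ps ! (g + Suc d)) (i + Suc d) \<le> (ps ! (g + d)) (i + d)"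
    using strip_sequence_step(2)[OF assms(1), of "g + d"] Suc.prems by simp
  also have "\<dots> \<le> (ps ! g) i"
    using Suc by simp
  finally show ?case .
qed simp

text \<open>
  Dividing by \<open>s\<close> numbers the blocks of equal rows from the top, and the truncated subtraction
  produces the infinite tail of zeros.
\<close>
lemma staircase_row:
  assumes "s > 0"
  shows "staircase w s k i = w * (k - 1 - i div s)"
proof (induction k arbitrary: i)
  case 0
  show ?case
    by (simp add: staircase_def staircase_parts_def)
next
  case (Suc k)
  show ?case
  proof (cases "k = 0")
    case True
    then show ?thesis
      by (simp add: staircase_def staircase_parts_def)
  next
    case False
    then have "staircase_parts w s (Suc k) = replicate s (w * k) @ staircase_parts w s k"
      by (simp add: staircase_parts_def)
    then have row: "staircase w s (Suc k) i = (if i < s then w * k else staircase w s k (i - s))"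
      by (simp add: staircase_def nth_default_append nth_default_nth)
    show ?thesis
    proof (cases "i < s")
      case True
      then show ?thesis
        using row by simp
    next
      case i: False
      then have "i div s = Suc ((i - s) div s)"
        using \<open>s > 0\<close> by (simp add: le_div_geq)
      then show ?thesis
        using row i Suc.IH[of "i - s"] by simp
    qed
  qed
qed

lemma intermediate_staircase_row:
  "intermediate_staircase w s k g i = (if i < g then w * k else staircase w s k (i - g))"
  by (simp add: intermediate_staircase_def staircase_def nth_default_append nth_default_nth)

lemma staircase_Suc_row_shift:
  assumes "s > 0"
  shows "staircase w s (Suc k) (i + s) = staircase w s k i"
proof -
  have "(i + s) div s = Suc (i div s)"
    using assms by (simp add: div_add_self2)
  then show ?thesis
    using assms by (simp only: staircase_row) simp
qed

lemma antimono_staircase: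
  assumes "s > 0" and "i \<le> j"
  shows "staircase w s k j \<le> staircase w s k i"
  using assms by (simp add: staircase_row diff_le_mono2 div_le_mono)

lemma staircase_row_le:
  assumes "s > 0"
  shows "staircase w s k i \<le> w * k"
  using assms by (simp add: staircase_row)

lemma is_partition_intermediate_staircase:
  assumes "s > 0"
  shows "is_partition (intermediate_staircase w s k g)"
  unfolding is_partition_def
proof
  show "antimono (intermediate_staircase w s k g)"
    using assms
    by (auto intro!: antimonoI antimono_staircase staircase_row_le
        simp: intermediate_staircase_row)
  show "finite {i. intermediate_staircase w s k g i \<noteq> 0}"
  proof (rule finite_subset)
    show "{i. intermediate_staircase w s k g i \<noteq> 0}
        \<subseteq> {..<length (replicate g (w * k) @ staircase_parts w s k)}"
      unfolding intermediate_staircase_def by (auto simp: nth_default_def split: if_splits)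
  qed simp
qed

lemma intermediate_staircase_le_Suc:
  assumes "s > 0"
  shows "intermediate_staircase w s k g \<le> intermediate_staircase w s k (Suc g)"
  using assms
  by (auto intro!: le_funI antimono_staircase staircase_row_le simp: intermediate_staircase_row)

lemma intermediate_staircase_Suc_row_Suc:
  "intermediate_staircase w s k (Suc g) (Suc i) = intermediate_staircase w s k g i"
  by (simp add: intermediate_staircase_row)

lemma strip_sequence_intermediate_staircases:
  assumes "k > 0" and "s > 0"
  shows "strip_sequence (staircase w s k) (staircase w s (k + 1)) s
    (map (\<lambda>g. intermediate_staircase w s k g) [0..<s + 1])"
    (is "strip_sequence _ _ _ ?ps")
proof -
  have nth: "?ps ! g = intermediate_staircase w s k g" if "g \<le> s" for g
    using that by (simp del: upt_Suc)
  have "?ps ! (i - 1) \<le> ?ps ! i \<and> horizontal_strip (skew_diagram (?ps ! i) (?ps ! (i - 1)))"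
    if "i \<in> {1..s}" for i
  proof -
    from that obtain g where g: "i = Suc g" "g < s"
      by (cases i) auto
    show ?thesis
      using g nth[of g] nth[of i] \<open>s > 0\<close>
      by (simp add: intermediate_staircase_le_Suc intermediate_staircase_Suc_row_Suc
          horizontal_strip_iff_interlacing is_partition_intermediate_staircase del: upt_Suc)
  qed
  moreover have "is_partition p" if "p \<in> set ?ps" for p
    using that is_partition_intermediate_staircase[OF \<open>s > 0\<close>] by auto
  moreover have "?ps ! 0 = staircase w s k"
    using nth[of 0] by (simp add: intermediate_staircase_0 del: upt_Suc)
  moreover have "?ps ! s = staircase w s (k + 1)"
    using nth[of s] \<open>k > 0\<close> by (simp add: intermediate_staircase_full del: upt_Suc)
  ultimately show ?thesis
    unfolding strip_sequence_def by simp
qed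

lemma strip_sequence_staircase_length_ge:
  assumes "k > 0" and "w > 0" and "s > 0"
    and seq: "strip_sequence (staircase w s k) (staircase w s (k + 1)) m ps"
  shows "s \<le> m"
proof (rule ccontr)
  assume "\<not> s \<le> m"
  have "(ps ! (0 + m)) (0 + m) \<le> (ps ! 0) 0"
    by (rule strip_sequence_shift[OF seq]) simp
  then have "staircase w s (k + 1) m \<le> staircase w s k 0"
    using seq by (simp add: strip_sequence_def)
  then have "w * k \<le> w * (k - 1)"
    using \<open>\<not> s \<le> m\<close> \<open>s > 0\<close> by (simp add: staircase_row)
  then show False
    using \<open>k > 0\<close> \<open>w > 0\<close> by simp
qed

lemma strip_sequence_staircase_nth:
  assumes "s > 0"
    and seq: "strip_sequence (staircase w s k) (staircase w s (k + 1)) s ps"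
    and "g \<le> s"
  shows "ps ! g = intermediate_staircase w s k g"
proof
  fix i
  have ends: "ps ! 0 = staircase w s k" "ps ! s = staircase w s (Suc k)"
    using seq by (simp_all add: strip_sequence_def)
  have lower: "staircase w s (Suc k) (i + (s - g)) \<le> (ps ! g) i"
    using strip_sequence_shift[OF seq, of g "s - g" i] \<open>g \<le> s\<close> ends by simp
  show "(ps ! g) i = intermediate_staircase w s k g i"
  proof (cases "i < g")
    case True
    have "ps ! g \<le> ps ! s"
      using strip_sequence_mono[OF seq, of g "s - g"] \<open>g \<le> s\<close> by simp
    then have "(ps ! g) i \<le> staircase w s (Suc k) i"
      using ends by (simp add: le_fun_def)
    moreover have "i < s" "i + (s - g) < s"
      using True \<open>g \<le> s\<close> by simp_all
    ultimately show ?thesis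
      using True lower \<open>s > 0\<close> by (simp add: staircase_row intermediate_staircase_row)
  next
    case False
    then have "i + (s - g) = (i - g) + s"
      using \<open>g \<le> s\<close> by simp
    then have "staircase w s k (i - g) \<le> (ps ! g) i"
      using lower \<open>s > 0\<close> by (simp only: staircase_Suc_row_shift)
    moreover have "(ps ! g) i \<le> staircase w s k (i - g)"
      using strip_sequence_shift[OF seq, of 0 g "i - g"] \<open>g \<le> s\<close> False ends by simp
    ultimately show ?thesis
      using False by (simp add: intermediate_staircase_row)
  qed
qed

theorem proposition3p2:
  fixes k w s :: nat
  assumes "k > 0" and "w > 0" and "s > 0"
  shows "(\<exists>ps. strip_sequence (staircase w s k) (staircase w s (k + 1)) s ps) \<and>
         (\<forall>m ps. strip_sequence (staircase w s k) (staircase w s (k + 1)) m ps \<longrightarrow> s \<le> m) \<and>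
         {ps. strip_sequence (staircase w s k) (staircase w s (k + 1)) s ps} =
           {map (\<lambda>g. intermediate_staircase w s k g) [0..<s + 1]}"
proof -
  have unique: "ps = map (\<lambda>g. intermediate_staircase w s k g) [0..<s + 1]"
    if seq: "strip_sequence (staircase w s k) (staircase w s (k + 1)) s ps" for ps
  proof (rule nth_equalityI)
    show len: "length ps = length (map (\<lambda>g. intermediate_staircase w s k g) [0..<s + 1])"
      using seq by (simp add: strip_sequence_def)
    fix g assume "g < length ps"
    then have "g \<le> s"
      using len by simp
    then show "ps ! g = map (\<lambda>g. intermediate_staircase w s k g) [0..<s + 1] ! g"
      using strip_sequence_staircase_nth[OF \<open>s > 0\<close> seq] by (simp del: upt_Suc)
  qed
  then show ?thesis
    using strip_sequence_intermediate_staircases[OF \<open>k > 0\<close> \<open>s > 0\<close>]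
      strip_sequence_staircase_length_ge[OF assms]
    by blast
qed

end
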